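(* Let $K$ be a subcomplex of a finite simplicial complex $L$, let $k\ge 0$, and let $[\beta]_K\in \mathrm{H}^k(K)$ die between $K$ and $L$. Then the death cochain for $[\beta]_K$ from $K$ to $L$ is the unique element of $$\operatorname*{arg\,min}_{\omega \in \mathrm{Z}^{k+1}(L, K)} \left\{ \|\omega\|_2 \;\middle|\; [\omega]_{(L,K)} = \lambda^{\#}([\beta]_{K}) \right\}.$$
   Context: All simplicial complexes are finite and all (co)homology has real coefficients. $\mathrm{C}^k(X)$ is the space of real-valued functions on the set of $k$-simplices of $X$ (with orientations fixed), with inner product $\langle\alpha,\beta\rangle=\sum_\sigma \alpha(\sigma)\beta(\sigma)$ and norm $\|\cdot\|_2$; $\delta_X^k:\mathrm{C}^k(X)\to \mathrm{C}^{k+1}(X)$ is the coboundary operator, and $[\alpha]_X\in \mathrm{H}^k(X)$ is the class of a cocycle $\alpha$. For $\varphi\in \mathrm{C}^k(L)$, $\varphi|_K$ is its restriction to the $k$-simplices of $K$. Relative cochains: $\mathrm{C}^k(L,K)=\{\varphi\in \mathrm{C}^k(L) : \varphi|_K=0\}$, with coboundary and norm induced from $L$; $\mathrm{Z}^k(L,K)$ denotes the relative cocycles, $\mathrm{H}^k(L,K)$ the relative cohomology, and $[\cdot]_{(L,K)}$ relative classes. The connecting homomorphism $\lambda^\#:\mathrm{H}^k(K)\to \mathrm{H}^{k+1}(L,K)$ is $\lambda^\#([\beta]_K)=[\delta_L^k\beta']_{(L,K)}$, where $\beta'\in \mathrm{C}^k(L)$ is any extension of $\beta$ (i.e. $\beta'|_K=\beta$).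 A class $[\beta]_K\in \mathrm{H}^k(K)$ dies between $K$ and $L$ if $\beta$ cannot be extended to a $k$-cocycle on $L$. In that case the death cochain for $[\beta]_K$ (with representative $\beta$) from $K$ to $L$ is $\delta_L^k\hat\beta$, where $\hat\beta$ is any element of $\operatorname{arg\,min}_{\beta'\in \mathrm{C}^k(L)}\{\|\delta_L^k\beta'\|_2 : \beta'|_K=\beta\}$. *)

theory Defs
  imports "HOL-Analysis.Analysis"
begin

text \<open>
  Finite abstract simplicial complexes. (The constant \<open>simplicial_complex\<close> of \<open>HOL-Analysis\<close> is
  about geometric complexes in a Euclidean space.) Simplices are nonempty, and a \<open>k\<close>-simplex
  has \<open>k + 1\<close> vertices. Cohomology is not reduced.
\<close>

definition abstract_complex :: "'v set set \<Rightarrow> bool" where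
  "abstract_complex X \<longleftrightarrow> finite X \<and> (\<forall>\<sigma>\<in>X. finite \<sigma> \<and> \<sigma> \<noteq> {})
     \<and> (\<forall>\<sigma>\<in>X. \<forall>\<tau>. \<tau> \<subseteq> \<sigma> \<and> \<tau> \<noteq> {} \<longrightarrow> \<tau> \<in> X)"

definition subcomplex :: "'v set set \<Rightarrow> 'v set set \<Rightarrow> bool" where
  "subcomplex K L \<longleftrightarrow> abstract_complex K \<and> abstract_complex L \<and> K \<subseteq> L"

definition simplices :: "'v set set \<Rightarrow> nat \<Rightarrow> 'v set set" where
  "simplices X k = {\<sigma> \<in> X. card \<sigma> = k + 1}"

text \<open>
  An orientation is an ordering of the vertices up to even permutations. It is given here by a
  representative ordering \<open>ori \<sigma>\<close> of each simplex \<open>\<sigma>\<close>; the choices for different simplices are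
  unrelated. A subcomplex carries the orientations of the ambient complex.
\<close>

definition orientation :: "'v set set \<Rightarrow> ('v set \<Rightarrow> 'v list) \<Rightarrow> bool" where
  "orientation X ori \<longleftrightarrow> (\<forall>\<sigma>\<in>X. distinct (ori \<sigma>) \<and> set (ori \<sigma>) = \<sigma>)"

text \<open>The sign of the permutation relating two orderings of the same set of vertices.\<close>

definition ordering_sign :: "'v list \<Rightarrow> 'v list \<Rightarrow> real" where
  "ordering_sign xs ys = of_int (sign (THE p. p permutes set xs \<and> map p xs = ys))"

definition drop_vertex :: "nat \<Rightarrow> 'v list \<Rightarrow> 'v list" where
  "drop_vertex i xs = take i xs @ drop (Suc i) xs"

text \<open>
  A real cochain is a function on the oriented \<open>k\<close>-simplices, extended by zero to all other sets,
  so that equality of cochains is equality of functions.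
\<close>

type_synonym 'v cochain = "'v set \<Rightarrow> real"

definition cochains :: "'v set set \<Rightarrow> nat \<Rightarrow> 'v cochain set" where
  "cochains X k = {\<phi>. \<forall>\<sigma>. \<sigma> \<notin> simplices X k \<longrightarrow> \<phi> \<sigma> = 0}"

definition cochain_norm :: "'v set set \<Rightarrow> nat \<Rightarrow> 'v cochain \<Rightarrow> real" where
  "cochain_norm X k \<phi> = L2_set \<phi> (simplices X k)"

definition restrict_cochain :: "'v set set \<Rightarrow> nat \<Rightarrow> 'v cochain \<Rightarrow> 'v cochain" where
  "restrict_cochain K k \<phi> = (\<lambda>\<sigma>. if \<sigma> \<in> simplices K k then \<phi> \<sigma> else 0)"

text \<open>
  For \<open>\<tau>\<close> oriented by the ordering \<open>v\<^sub>0, \<dots>, v\<^sub>k\<^sub>+\<^sub>1\<close>, the value at \<open>\<tau>\<close> is the sum of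
  \<open>(-1)\<^sup>i \<phi>(v\<^sub>0, \<dots>, v\<^sub>i\<^sub>-\<^sub>1, v\<^sub>i\<^sub>+\<^sub>1, \<dots>, v\<^sub>k\<^sub>+\<^sub>1)\<close>. The factor \<open>ordering_sign\<close> compares the ordering induced
  on each face with the fixed orientation of that face.
\<close>

definition coboundary ::
  "('v set \<Rightarrow> 'v list) \<Rightarrow> 'v set set \<Rightarrow> nat \<Rightarrow> 'v cochain \<Rightarrow> 'v cochain" where
  "coboundary ori X k \<phi> = (\<lambda>\<tau>. if \<tau> \<in> simplices X (k + 1)
     then (\<Sum>i\<le>k + 1. (- 1) ^ i
             * ordering_sign (ori (\<tau> - {ori \<tau> ! i})) (drop_vertex i (ori \<tau>))
             * \<phi> (\<tau> - {ori \<tau> ! i}))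
     else 0)"

definition cocycles :: "('v set \<Rightarrow> 'v list) \<Rightarrow> 'v set set \<Rightarrow> nat \<Rightarrow> 'v cochain set" where
  "cocycles ori X k = {\<phi> \<in> cochains X k. coboundary ori X k \<phi> = (\<lambda>_. 0)}"

definition coboundaries :: "('v set \<Rightarrow> 'v list) \<Rightarrow> 'v set set \<Rightarrow> nat \<Rightarrow> 'v cochain set" where
  "coboundaries ori X k =
     (case k of 0 \<Rightarrow> {\<lambda>_. 0} | Suc j \<Rightarrow> coboundary ori X j ` cochains X j)"

text \<open>Cohomology classes are cosets of the space of coboundaries.\<close>

definition coh_class ::
  "('v set \<Rightarrow> 'v list) \<Rightarrow> 'v set set \<Rightarrow> nat \<Rightarrow> 'v cochain \<Rightarrow> 'v cochain set" where
  "coh_class ori X k \<alpha> = {\<lambda>\<sigma>. \<alpha> \<sigma> + \<gamma> \<sigma> | \<gamma>. \<gamma> \<in> coboundaries ori X k}"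

definition rel_cochains :: "'v set set \<Rightarrow> 'v set set \<Rightarrow> nat \<Rightarrow> 'v cochain set" where
  "rel_cochains L K k = {\<phi> \<in> cochains L k. restrict_cochain K k \<phi> = (\<lambda>_. 0)}"

definition rel_cocycles ::
  "('v set \<Rightarrow> 'v list) \<Rightarrow> 'v set set \<Rightarrow> 'v set set \<Rightarrow> nat \<Rightarrow> 'v cochain set" where
  "rel_cocycles ori L K k = {\<phi> \<in> rel_cochains L K k. coboundary ori L k \<phi> = (\<lambda>_. 0)}"

definition rel_coboundaries ::
  "('v set \<Rightarrow> 'v list) \<Rightarrow> 'v set set \<Rightarrow> 'v set set \<Rightarrow> nat \<Rightarrow> 'v cochain set" where
  "rel_coboundaries ori L K k =
     (case k of 0 \<Rightarrow> {\<lambda>_. 0} | Suc j \<Rightarrow> coboundary ori L j ` rel_cochains L K j)"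

definition rel_coh_class ::
  "('v set \<Rightarrow> 'v list) \<Rightarrow> 'v set set \<Rightarrow> 'v set set \<Rightarrow> nat \<Rightarrow> 'v cochain \<Rightarrow> 'v cochain set" where
  "rel_coh_class ori L K k \<alpha> = {\<lambda>\<sigma>. \<alpha> \<sigma> + \<gamma> \<sigma> | \<gamma>. \<gamma> \<in> rel_coboundaries ori L K k}"

text \<open>
  The connecting homomorphism acts on classes. The definite description says that the class of
  the coboundary of an extension depends neither on the extension nor on the representative
  that is extended.
\<close>

definition connecting_hom ::
  "('v set \<Rightarrow> 'v list) \<Rightarrow> 'v set set \<Rightarrow> 'v set set \<Rightarrow> nat \<Rightarrow> 'v cochain set \<Rightarrow> 'v cochain set" where
  "connecting_hom ori L K k c =
     (THE d. \<exists>\<beta>\<in>c. \<exists>\<beta>'\<in>cochains L k. restrict_cochain K k \<beta>' = \<beta>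
        \<and> d = rel_coh_class ori L K (k + 1) (coboundary ori L k \<beta>'))"

definition dies ::
  "('v set \<Rightarrow> 'v list) \<Rightarrow> 'v set set \<Rightarrow> 'v set set \<Rightarrow> nat \<Rightarrow> 'v cochain \<Rightarrow> bool" where
  "dies ori K L k \<beta> \<longleftrightarrow> \<not> (\<exists>\<beta>'\<in>cocycles ori L k. restrict_cochain K k \<beta>' = \<beta>)"

text \<open>A relation, because the minimizing extension need not be unique.\<close>

definition death_cochain ::
  "('v set \<Rightarrow> 'v list) \<Rightarrow> 'v set set \<Rightarrow> 'v set set \<Rightarrow> nat \<Rightarrow> 'v cochain \<Rightarrow> 'v cochain \<Rightarrow> bool" where
  "death_cochain ori K L k \<beta> \<omega> \<longleftrightarrow>
     (\<exists>\<beta>h. is_arg_min (\<lambda>\<beta>'. cochain_norm L (k + 1) (coboundary ori L k \<beta>'))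
             (\<lambda>\<beta>'. \<beta>' \<in> cochains L k \<and> restrict_cochain K k \<beta>' = \<beta>) \<beta>h
        \<and> \<omega> = coboundary ori L k \<beta>h)"

end

theory Submission
  imports Defs
begin

text \<open>
  The coboundaries of the extensions of \<open>\<beta>\<close> to \<open>L\<close> form a translate of the space of relative
  coboundaries of degree \<open>k + 1\<close>, and this translate, regarded as a coset, is exactly the relative
  class obtained from \<open>\<beta>\<close> by the connecting homomorphism. Hence both minimization problems have
  the same set of competitors. This set is an affine subspace of a finite-dimensional Euclidean
  space, so that it contains a unique vector of least norm, namely the one orthogonal to its
  direction.
\<close>

section \<open>Signs of orderings\<close>

text \<open>Gives the definite description in \<open>ordering_sign\<close> a meaning: matching
  entries position by position fixes the permutation on \<open>set xs\<close>, and
  \<open>permutes\<close> forces the identity elsewhere.\<close>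

lemma ordering_perm_ex1:
  assumes "distinct xs" "distinct ys" "set xs = set ys"
  shows "\<exists>!p. p permutes set xs \<and> map p xs = ys"
proof -
  have len: "length xs = length ys"
    using assms by (metis distinct_card)
  define p where "p = (\<lambda>x. if x \<in> set xs then the (map_of (zip xs ys) x) else x)"
  have map_p: "map p xs = ys"
    by (rule nth_equalityI) (use len assms in \<open>auto simp: p_def map_of_zip_nth\<close>)
  have image_p: "p ` set xs = set xs"
    using map_p assms(3) by (metis set_map)
  then have "inj_on p (set xs)"
    by (simp add: eq_card_imp_inj_on)
  with image_p have "p permutes set xs"
    by (intro bij_imp_permutes) (auto simp: bij_betw_def p_def)
  moreover have "q = r"
    if "q permutes set xs" "map q xs = ys" "r permutes set xs" "map r xs = ys" for q r
  proof
    fix x show "q x = r x"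
    proof (cases "x \<in> set xs")
      case True
      then show ?thesis using that(2,4) by (metis map_eq_conv)
    next
      case False
      then show ?thesis using that(1,3) by (simp add: permutes_not_in)
    qed
  qed
  ultimately show ?thesis using map_p by blast
qed

lemma ordering_sign_eq:
  assumes "distinct xs" "p permutes set xs" "map p xs = ys"
  shows "ordering_sign xs ys = of_int (sign p)"
proof -
  have "distinct ys" "set xs = set ys"
    using assms by (auto simp: distinct_map permutes_inj_on permutes_image)
  then have "(THE q. q permutes set xs \<and> map q xs = ys) = p"
    using ordering_perm_ex1[of xs ys] assms by (intro the1_equality) auto
  then show ?thesis by (simp add: ordering_sign_def)
qed

text \<open>Reorderings compose, and the sign of permutations is multiplicative.\<close>

lemma ordering_sign_trans:
  assumes "distinct xs" "distinct ys" "distinct zs" "set xs = set ys" "set ys = set zs"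
  shows "ordering_sign xs ys * ordering_sign ys zs = ordering_sign xs zs"
proof -
  obtain p where p: "p permutes set xs" "map p xs = ys"
    using ordering_perm_ex1 assms by blast
  obtain q where q: "q permutes set ys" "map q ys = zs"
    using ordering_perm_ex1 assms by blast
  have qp: "q \<circ> p permutes set xs" "map (q \<circ> p) xs = zs"
    using p q assms permutes_compose[of p "set xs" q] by (auto simp flip: map_map)
  have "sign (q \<circ> p) = sign q * sign p"
    using p(1) q(1) by (intro sign_compose) (auto intro: permutes_imp_permutation[OF finite_set])
  then show ?thesis
    using ordering_sign_eq[OF assms(1) p] ordering_sign_eq[OF assms(2) q]
      ordering_sign_eq[OF assms(1) qp]
    by simp
qed

text \<open>The permutation taking \<open>xs\<close> to \<open>ys\<close> fixes \<open>a\<close>, so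
  the same permutation serves for the longer lists.\<close>

lemma ordering_sign_Cons:
  assumes "distinct xs" "distinct ys" "set xs = set ys" "a \<notin> set xs"
  shows "ordering_sign (a # xs) (a # ys) = ordering_sign xs ys"
proof -
  obtain p where p: "p permutes set xs" "map p xs = ys"
    using ordering_perm_ex1 assms by blast
  have "p permutes set (a # xs)" "map p (a # xs) = a # ys"
    using p assms(4) permutes_subset[OF p(1), of "set (a # xs)"] by (auto simp: permutes_not_in)
  then show ?thesis
    using ordering_sign_eq[OF assms(1) p] ordering_sign_eq[of "a # xs" p "a # ys"] assms by simp
qed

lemma ordering_sign_refl: "distinct xs \<Longrightarrow> ordering_sign xs xs = 1"
  using ordering_sign_eq[of xs id xs] by (simp add: permutes_id)

lemma ordering_sign_swap:
  assumes "distinct (a # b # xs)"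
  shows "ordering_sign (a # b # xs) (b # a # xs) = - 1"
proof -
  \<comment> \<open>The transposition leaves the tail alone, since neither \<open>a\<close> nor
    \<open>b\<close> occurs in it.\<close>
  have "map (Transposition.transpose a b) xs = map (\<lambda>x. x) xs"
    by (rule map_cong) (use assms in \<open>auto simp: Transposition.transpose_def\<close>)
  then have "ordering_sign (a # b # xs) (b # a # xs) = of_int (sign (Transposition.transpose a b))"
    using assms by (intro ordering_sign_eq permutes_swap_id) auto
  then show ?thesis using assms by (simp add: sign_swap_id)
qed

lemma set_drop_vertex:
  assumes "distinct xs" "i < length xs"
  shows "set (drop_vertex i xs) = set xs - {xs ! i}"
proof -
  have "xs = take i xs @ xs ! i # drop (Suc i) xs"
    using assms(2) by (rule id_take_nth_drop)
  with assms(1) have "distinct (take i xs @ xs ! i # drop (Suc i) xs)"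
    and "set xs = set (take i xs @ xs ! i # drop (Suc i) xs)"
    by metis+
  then show ?thesis by (auto simp: drop_vertex_def)
qed

lemma distinct_drop_vertex: "distinct xs \<Longrightarrow> distinct (drop_vertex i xs)"
  using set_take_disj_set_drop_if_distinct[of xs i "Suc i"] by (auto simp: drop_vertex_def)

text \<open>The entry at position \<open>i\<close> passes \<open>i\<close> others on its way to the
  front, each passage being one transposition. The induction first moves it to the front of the tail
  and then past the head.\<close>

lemma ordering_sign_move_to_front:
  assumes "distinct xs" "i < length xs"
  shows "ordering_sign xs (xs ! i # drop_vertex i xs) = (- 1) ^ i"
  using assms
proof (induction xs arbitrary: i)
  case (Cons x xs)
  show ?case
  proof (cases i)
    case 0
    then show ?thesis
      using Cons.prems ordering_sign_refl[of "x # xs"] by (simp add: drop_vertex_def)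
  next
    case (Suc j)
    let ?r = "drop_vertex j xs" and ?b = "xs ! j"
    have xs: "distinct xs" "x \<notin> set xs" "j < length xs" using Cons.prems Suc by auto
    have b: "?b \<in> set xs" "set ?r = set xs - {?b}" "distinct ?r" "?b \<noteq> x"
      using xs nth_mem[of j xs] by (auto simp: set_drop_vertex distinct_drop_vertex simp del: nth_mem)
    have "ordering_sign (x # xs) (x # ?b # ?r) = ordering_sign xs (?b # ?r)"
      by (rule ordering_sign_Cons) (simp_all add: xs b insert_absorb)
    also have "\<dots> = (- 1) ^ j"
      using Cons.IH xs by simp
    finally have "ordering_sign (x # xs) (x # ?b # ?r) = (- 1) ^ j" .
    moreover have "ordering_sign (x # ?b # ?r) (?b # x # ?r) = - 1"
      by (rule ordering_sign_swap) (simp_all add: xs b insert_absorb)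
    moreover have "ordering_sign (x # xs) (x # ?b # ?r) * ordering_sign (x # ?b # ?r) (?b # x # ?r)
        = ordering_sign (x # xs) (?b # x # ?r)"
      by (rule ordering_sign_trans) (simp_all add: xs b insert_absorb insert_commute[of "?b" x])
    ultimately show ?thesis using Suc by (simp add: drop_vertex_def)
  qed
qed simp

text \<open>Absorbs the alternating sign of the coboundary formula: the resulting incidence number
  of a face mentions the removed vertex but no longer its position.\<close>

lemma ordering_sign_drop_vertex:
  assumes "distinct xs" "i < length xs" "distinct zs" "set zs = set xs - {xs ! i}"
  shows "(- 1) ^ i * ordering_sign zs (drop_vertex i xs) = ordering_sign (xs ! i # zs) xs"
proof -
  let ?a = "xs ! i" and ?r = "drop_vertex i xs"
  have a: "?a \<in> set xs" "set ?r = set xs - {?a}" "distinct ?r"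
    using assms by (simp_all add: set_drop_vertex distinct_drop_vertex)
  have "ordering_sign (?a # zs) xs * ordering_sign xs (?a # ?r) = ordering_sign (?a # zs) (?a # ?r)"
    by (rule ordering_sign_trans) (simp_all add: assms a insert_absorb)
  also have "\<dots> = ordering_sign zs ?r"
    by (rule ordering_sign_Cons) (simp_all add: assms a insert_absorb)
  finally have "ordering_sign zs ?r = ordering_sign (?a # zs) xs * (- 1) ^ i"
    by (simp add: ordering_sign_move_to_front assms(1,2))
  \<comment> \<open>The power of -1 is its own inverse and can be moved across the equation.\<close>
  moreover have "(- 1) ^ i * ((- 1) ^ i :: real) = 1" by (simp flip: power_mult_distrib)
  ultimately show ?thesis by (simp add: mult.left_commute)
qed

section \<open>The coboundary operator\<close>

lemma simplices_face:
  assumes "abstract_complex X" "\<tau> \<in> simplices X (Suc k)" "a \<in> \<tau>"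
  shows "\<tau> - {a} \<in> simplices X k"
proof -
  have \<tau>: "\<tau> \<in> X" "card \<tau> = k + 2" using assms(2) by (auto simp: simplices_def)
  then have "card (\<tau> - {a}) = k + 1" using assms(3) by simp
  moreover from this have "\<tau> - {a} \<noteq> {}" by force
  moreover from this have "\<tau> - {a} \<in> X"
    using assms(1) \<tau>(1) unfolding abstract_complex_def by (meson Diff_subset)
  ultimately show ?thesis by (simp add: simplices_def)
qed

text \<open>Positions in \<open>ori \<tau>\<close> correspond bijectively to vertices of
  \<open>\<tau>\<close>, so the sum can run over vertices. In this form, double coboundaries become
  sums over pairs of vertices.\<close>

lemma coboundary_eq_sum:
  assumes X: "abstract_complex X" "orientation X ori" and \<tau>: "\<tau> \<in> simplices X (Suc k)"
  shows "coboundary ori X k \<phi> \<tau>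
    = (\<Sum>a\<in>\<tau>. ordering_sign (a # ori (\<tau> - {a})) (ori \<tau>) * \<phi> (\<tau> - {a}))"
proof -
  let ?xs = "ori \<tau>" and ?g = "\<lambda>a. ordering_sign (a # ori (\<tau> - {a})) (ori \<tau>) * \<phi> (\<tau> - {a})"
  have xs: "distinct ?xs" "set ?xs = \<tau>"
    using X(2) \<tau> by (auto simp: orientation_def simplices_def)
  have "length ?xs = k + 2"
    using \<tau> distinct_card[OF xs(1)] xs(2) by (simp add: simplices_def)
  then have len: "{..<length ?xs} = {..k + 1}" by auto
  have "bij_betw ((!) ?xs) {..k + 1} \<tau>"
    using bij_betw_nth[OF xs(1) len[symmetric]] xs(2) by simp
  then have "sum ?g \<tau> = (\<Sum>i\<le>k + 1. ?g (?xs ! i))"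
    using sum.reindex_bij_betw[of _ _ _ ?g, symmetric] by blast
  also have "\<dots> = (\<Sum>i\<le>k + 1. (- 1) ^ i
             * ordering_sign (ori (\<tau> - {?xs ! i})) (drop_vertex i ?xs) * \<phi> (\<tau> - {?xs ! i}))"
  proof (rule sum.cong)
    fix i assume "i \<in> {..k + 1}"
    then have i: "i < length ?xs" using len by blast
    then have "?xs ! i \<in> \<tau>" using nth_mem xs(2) by metis
    then have "\<tau> - {?xs ! i} \<in> X"
      using simplices_face[OF X(1) \<tau>] by (simp add: simplices_def)
    then have "distinct (ori (\<tau> - {?xs ! i}))" "set (ori (\<tau> - {?xs ! i})) = set ?xs - {?xs ! i}"
      using X(2) xs(2) by (auto simp: orientation_def)
    then show "?g (?xs ! i)
        = (- 1) ^ i * ordering_sign (ori (\<tau> - {?xs ! i})) (drop_vertex i ?xs) * \<phi> (\<tau> - {?xs ! i})"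
      using ordering_sign_drop_vertex[OF xs(1) i] by simp
  qed simp
  finally show ?thesis using \<tau> by (simp add: coboundary_def del: sum.atMost_Suc)
qed

text \<open>Each face of codimension two is reached by removing its two missing vertices in either
  order, and the two contributions have opposite signs.\<close>

lemma coboundary_coboundary:
  assumes X: "abstract_complex X" "orientation X ori"
  shows "coboundary ori X (Suc k) (coboundary ori X k \<phi>) = (\<lambda>_. 0)"
proof
  fix \<tau>
  show "coboundary ori X (Suc k) (coboundary ori X k \<phi>) \<tau> = 0"
  proof (cases "\<tau> \<in> simplices X (Suc k + 1)")
    case True
    then have \<tau>: "\<tau> \<in> simplices X (Suc (Suc k))" by simp
    then have fin: "finite \<tau>" using X by (auto simp: simplices_def abstract_complex_def)
    \<comment> \<open>The contribution of removing first \<open>a\<close> and then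
      \<open>b\<close>.\<close>
    define g where "g = (\<lambda>(a, b).
      ordering_sign (a # ori (\<tau> - {a})) (ori \<tau>) * ordering_sign (b # ori (\<tau> - {a} - {b})) (ori (\<tau> - {a}))
        * \<phi> (\<tau> - {a} - {b}))"
    define P where "P = (SIGMA a:\<tau>. \<tau> - {a})"
    have dist_ori: "distinct (ori \<sigma>)" "set (ori \<sigma>) = \<sigma>" if "\<sigma> \<in> simplices X j" for \<sigma> j
      using X(2) that by (auto simp: orientation_def simplices_def)
    \<comment> \<open>The orientation chosen for the intermediate face \<open>\<tau> - {a}\<close>
      cancels, because signs compose.\<close>
    have g_eq: "g (a, b)
        = ordering_sign (a # b # ori (\<tau> - {a} - {b})) (ori \<tau>) * \<phi> (\<tau> - {a} - {b})"
      if ab: "a \<in> \<tau>" "b \<in> \<tau>" "a \<noteq> b" for a b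
    proof -
      let ?v = "ori (\<tau> - {a})" and ?w = "ori (\<tau> - {a} - {b})"
      have a: "\<tau> - {a} \<in> simplices X (Suc k)"
        using simplices_face[OF X(1) \<tau>] ab by simp
      have b: "\<tau> - {a} - {b} \<in> simplices X k"
        using simplices_face[OF X(1) a] ab by simp
      note o = dist_ori[OF \<tau>] dist_ori[OF a] dist_ori[OF b]
      have "ordering_sign (a # b # ?w) (a # ?v) = ordering_sign (b # ?w) ?v"
        using o ab by (intro ordering_sign_Cons) auto
      moreover have "ordering_sign (a # b # ?w) (a # ?v) * ordering_sign (a # ?v) (ori \<tau>)
          = ordering_sign (a # b # ?w) (ori \<tau>)"
        using o ab by (intro ordering_sign_trans) auto
      ultimately show ?thesis by (simp add: g_def mult.commute)
    qed
    have g_swap: "g (b, a) = - g (a, b)" if ab: "a \<in> \<tau>" "b \<in> \<tau>" "a \<noteq> b" for a b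
    proof -
      let ?w = "ori (\<tau> - {a} - {b})"
      have w: "\<tau> - {a} - {b} \<in> simplices X k"
        using simplices_face[OF X(1) simplices_face[OF X(1) \<tau>]] ab by simp
      note o = dist_ori[OF \<tau>] dist_ori[OF w]
      have "ordering_sign (b # a # ?w) (a # b # ?w) = - 1"
        using o ab by (intro ordering_sign_swap) auto
      moreover have "ordering_sign (b # a # ?w) (a # b # ?w) * ordering_sign (a # b # ?w) (ori \<tau>)
          = ordering_sign (b # a # ?w) (ori \<tau>)"
        using o ab by (intro ordering_sign_trans) auto
      ultimately have "ordering_sign (b # a # ?w) (ori \<tau>) = - ordering_sign (a # b # ?w) (ori \<tau>)"
        by simp
      moreover have "\<tau> - {b} - {a} = \<tau> - {a} - {b}" by auto
      ultimately show ?thesis using g_eq[of a b] g_eq[of b a] ab by simp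
    qed
    have "coboundary ori X (Suc k) (coboundary ori X k \<phi>) \<tau> = (\<Sum>a\<in>\<tau>. \<Sum>b\<in>\<tau> - {a}. g (a, b))"
      using coboundary_eq_sum[OF X, of \<tau> "Suc k"] coboundary_eq_sum[OF X, of _ k]
        simplices_face[OF X(1) \<tau>] \<tau>
      by (simp add: g_def sum_distrib_left mult.assoc)
    also have "\<dots> = sum g P"
      using fin by (simp add: P_def sum.Sigma)
    finally have eq: "coboundary ori X (Suc k) (coboundary ori X k \<phi>) \<tau> = sum g P" .
    \<comment> \<open>Swapping the vertices maps \<open>P\<close> onto itself and negates every
      term, so the sum equals its own negative.\<close>
    have "sum g P = (\<Sum>p\<in>P. g (prod.swap p))"
      by (rule sum.reindex_bij_witness[of _ prod.swap prod.swap]) (auto simp: P_def)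
    also have "\<dots> = (\<Sum>p\<in>P. - g p)"
      by (rule sum.cong) (auto simp: P_def intro!: g_swap)
    finally have "sum g P = - sum g P" by (simp add: sum_negf)
    then show ?thesis using eq by simp
  qed (simp add: coboundary_def)
qed

lemma coboundary_in_cochains: "coboundary ori X k \<phi> \<in> cochains X (k + 1)"
  by (simp add: cochains_def coboundary_def)

lemma coboundary_sum:
  "coboundary ori X k (\<lambda>\<sigma>. \<Sum>i\<in>I. c i * \<phi> i \<sigma>) = (\<lambda>\<tau>. \<Sum>i\<in>I. c i * coboundary ori X k (\<phi> i) \<tau>)"
proof
  fix \<tau>
  show "coboundary ori X k (\<lambda>\<sigma>. \<Sum>i\<in>I. c i * \<phi> i \<sigma>) \<tau> = (\<Sum>i\<in>I. c i * coboundary ori X k (\<phi> i) \<tau>)"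
    unfolding coboundary_def
    by (simp add: sum_distrib_left sum_distrib_right algebra_simps del: sum.atMost_Suc)
      (subst sum.swap, simp del: sum.atMost_Suc)
qed

lemma coboundary_add:
  "coboundary ori X k (\<lambda>\<sigma>. \<phi> \<sigma> + \<psi> \<sigma>) = (\<lambda>\<tau>. coboundary ori X k \<phi> \<tau> + coboundary ori X k \<psi> \<tau>)"
  by (rule ext) (simp add: coboundary_def sum.distrib distrib_left del: sum.atMost_Suc)

lemma coboundary_diff:
  "coboundary ori X k (\<lambda>\<sigma>. \<phi> \<sigma> - \<psi> \<sigma>) = (\<lambda>\<tau>. coboundary ori X k \<phi> \<tau> - coboundary ori X k \<psi> \<tau>)"
  by (rule ext) (simp add: coboundary_def sum_subtractf right_diff_distrib del: sum.atMost_Suc)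

text \<open>All faces of a simplex of \<open>K\<close> lie in \<open>K\<close> and carry the same
  orientations there as in \<open>L\<close>, so the sums on both sides have the same terms.\<close>

lemma restrict_coboundary:
  assumes KL: "subcomplex K L" and ori: "orientation L ori"
  shows "restrict_cochain K (Suc k) (coboundary ori L k \<phi>)
    = coboundary ori K k (restrict_cochain K k \<phi>)"
proof
  fix \<tau>
  have K: "abstract_complex K" and L: "abstract_complex L" and sub: "K \<subseteq> L"
    using KL by (auto simp: subcomplex_def)
  have oriK: "orientation K ori" using ori sub by (auto simp: orientation_def)
  show "restrict_cochain K (Suc k) (coboundary ori L k \<phi>) \<tau>
      = coboundary ori K k (restrict_cochain K k \<phi>) \<tau>"
  proof (cases "\<tau> \<in> simplices K (Suc k)")
    case True
    then have "\<tau> \<in> simplices L (Suc k)" using sub by (auto simp: simplices_def)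
    then show ?thesis
      using True simplices_face[OF K True] coboundary_eq_sum[OF L ori, of \<tau> k]
        coboundary_eq_sum[OF K oriK, of \<tau> k]
      by (simp add: restrict_cochain_def)
  qed (simp add: restrict_cochain_def coboundary_def)
qed

section \<open>Vectors of least norm in affine subspaces\<close>

text \<open>Orthogonal projection onto a finite span by a Gram-Schmidt step, without assuming linear
  independence. The vector \<open>a\<close> varies in the induction because the hypothesis is
  applied both to \<open>a\<close> and to the new spanning vector.\<close>

lemma ex_orthogonal_residual:
  fixes f :: "'i \<Rightarrow> 'a \<Rightarrow> real"
  assumes "finite I" "finite S"
  shows "\<exists>c. \<forall>j\<in>I. (\<Sum>s\<in>S. (a s + (\<Sum>i\<in>I. c i * f i s)) * f j s) = 0"
  using assms(1)
proof (induction I arbitrary: a)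
  case (insert x I)
  obtain c where c: "(\<Sum>s\<in>S. (a s + (\<Sum>i\<in>I. c i * f i s)) * f j s) = 0" if "j \<in> I" for j
    using insert.IH[of a] by blast
  obtain d where d: "(\<Sum>s\<in>S. (f x s + (\<Sum>i\<in>I. d i * f i s)) * f j s) = 0" if "j \<in> I" for j
    using insert.IH[of "f x"] by blast
  \<comment> \<open>\<open>r\<close> and \<open>g\<close> are the residuals of \<open>a\<close> and
    of \<open>f x\<close> with respect to the old spanning vectors.\<close>
  define r where "r = (\<lambda>s. a s + (\<Sum>i\<in>I. c i * f i s))"
  define g where "g = (\<lambda>s. f x s + (\<Sum>i\<in>I. d i * f i s))"
  have r: "(\<Sum>s\<in>S. r s * f j s) = 0" and g: "(\<Sum>s\<in>S. g s * f j s) = 0" if "j \<in> I" for j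
    using c d that by (auto simp: r_def g_def)
  \<comment> \<open>Since \<open>g\<close> differs from \<open>f x\<close> by an element of the old
    span, a vector orthogonal to that span cannot distinguish the two.\<close>
  have with_x: "(\<Sum>s\<in>S. h s * f x s) = (\<Sum>s\<in>S. h s * g s)"
    if "\<And>j. j \<in> I \<Longrightarrow> (\<Sum>s\<in>S. h s * f j s) = 0" for h
  proof -
    have "(\<Sum>s\<in>S. h s * g s) = (\<Sum>s\<in>S. h s * f x s) + (\<Sum>s\<in>S. \<Sum>i\<in>I. d i * (h s * f i s))"
      by (simp add: g_def distrib_left sum.distrib sum_distrib_left mult.left_commute)
    also have "(\<Sum>s\<in>S. \<Sum>i\<in>I. d i * (h s * f i s)) = (\<Sum>i\<in>I. d i * (\<Sum>s\<in>S. h s * f i s))"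
      by (subst sum.swap) (simp add: sum_distrib_left)
    also have "\<dots> = 0" using that by simp
    finally show ?thesis by simp
  qed
  \<comment> \<open>Chosen to make \<open>r + t g\<close> orthogonal to \<open>g\<close>. If
    \<open>g\<close> vanishes on \<open>S\<close>, division by zero gives \<open>t = 0\<close>, and
    the orthogonality is trivial.\<close>
  define t where "t = - (\<Sum>s\<in>S. r s * g s) / (\<Sum>s\<in>S. g s * g s)"
  \<comment> \<open>The coefficients of \<open>r + t g\<close> once \<open>g\<close> is expanded in
    terms of \<open>f x\<close> and the old vectors.\<close>
  define e where "e = (\<lambda>i. if i = x then t else c i + t * d i)"
  have res: "a s + (\<Sum>i\<in>insert x I. e i * f i s) = r s + t * g s" for s
  proof -
    have "(\<Sum>i\<in>I. e i * f i s) = (\<Sum>i\<in>I. c i * f i s + t * (d i * f i s))"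
      by (rule sum.cong) (use insert.hyps in \<open>auto simp: e_def algebra_simps\<close>)
    then show ?thesis
      using insert.hyps
      by (simp add: e_def r_def g_def sum.distrib sum_distrib_left algebra_simps)
  qed
  have expand: "(\<Sum>s\<in>S. (r s + t * g s) * h s) = (\<Sum>s\<in>S. r s * h s) + t * (\<Sum>s\<in>S. g s * h s)" for h
    by (simp add: sum.distrib sum_distrib_left algebra_simps)
  have orth_g: "(\<Sum>s\<in>S. r s * g s) + t * (\<Sum>s\<in>S. g s * g s) = 0"
  proof (cases "(\<Sum>s\<in>S. g s * g s) = 0")
    case True
    then have "g s = 0" if "s \<in> S" for s
      using that assms(2) by (simp add: sum_nonneg_eq_0_iff)
    then show ?thesis by simp
  qed (simp add: t_def)
  have "(\<Sum>s\<in>S. (r s + t * g s) * f j s) = 0" if "j \<in> insert x I" for j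
    using that orth_g r g with_x[OF r] with_x[OF g] unfolding expand by auto
  then have "\<forall>j\<in>insert x I. (\<Sum>s\<in>S. (a s + (\<Sum>i\<in>insert x I. e i * f i s)) * f j s) = 0"
    by (simp only: res) blast
  then show ?case by blast
qed simp

text \<open>Pythagoras: the cross term of the expanded square vanishes.\<close>

lemma L2_set_add_orthogonal:
  assumes "(\<Sum>s\<in>S. r s * v s) = 0"
  shows "(L2_set (\<lambda>s. r s + v s) S)\<^sup>2 = (L2_set r S)\<^sup>2 + (L2_set v S)\<^sup>2"
proof -
  have "(\<Sum>s\<in>S. (r s + v s)\<^sup>2) = (\<Sum>s\<in>S. (r s)\<^sup>2) + 2 * (\<Sum>s\<in>S. r s * v s) + (\<Sum>s\<in>S. (v s)\<^sup>2)"
    by (simp add: power2_sum sum.distrib sum_distrib_left algebra_simps)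
  then show ?thesis using assms by (simp add: L2_set_def sum_nonneg)
qed

section \<open>Extensions and the connecting homomorphism\<close>

text \<open>Expansion in the standard basis, used to exhibit the relative coboundaries as a finite
  span.\<close>

lemma cochain_eq_sum_indicators:
  fixes \<phi> :: "'v cochain"
  assumes "finite I" "\<And>\<sigma>. \<sigma> \<notin> I \<Longrightarrow> \<phi> \<sigma> = 0"
  shows "\<phi> = (\<lambda>\<sigma>. \<Sum>\<rho>\<in>I. \<phi> \<rho> * indicator {\<rho>} \<sigma>)"
proof
  fix \<sigma>
  have "(\<Sum>\<rho>\<in>I. \<phi> \<rho> * indicator {\<rho>} \<sigma>) = (\<Sum>\<rho>\<in>I. if \<sigma> = \<rho> then \<phi> \<rho> else 0)"
    by (rule sum.cong) (auto simp: indicator_def)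
  then show "\<phi> \<sigma> = (\<Sum>\<rho>\<in>I. \<phi> \<rho> * indicator {\<rho>} \<sigma>)"
    using assms by (cases "\<sigma> \<in> I") auto
qed

lemma rel_cochains_iff:
  "\<phi> \<in> rel_cochains L K k \<longleftrightarrow> (\<forall>\<sigma>. \<sigma> \<notin> simplices L k - simplices K k \<longrightarrow> \<phi> \<sigma> = 0)"
  by (auto simp: rel_cochains_def cochains_def restrict_cochain_def fun_eq_iff)

text \<open>Cochains vanish off their simplices, so \<open>\<beta>\<close> itself serves as its
  extension by zero to \<open>L\<close>. All extensions then form the translate by
  \<open>\<beta>\<close> of the relative cochains.\<close>

lemma extension_iff:
  assumes "subcomplex K L" "\<beta> \<in> cochains K k"
  shows "\<beta>' \<in> cochains L k \<and> restrict_cochain K k \<beta>' = \<beta>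
    \<longleftrightarrow> (\<lambda>\<sigma>. \<beta>' \<sigma> - \<beta> \<sigma>) \<in> rel_cochains L K k"
proof -
  have "simplices K k \<subseteq> simplices L k"
    using assms(1) by (auto simp: subcomplex_def simplices_def)
  moreover have "\<beta> \<sigma> = 0" if "\<sigma> \<notin> simplices K k" for \<sigma>
    using assms(2) that by (simp add: cochains_def)
  ultimately show ?thesis
    unfolding rel_cochains_iff cochains_def restrict_cochain_def fun_eq_iff
    by (auto split: if_splits) (metis diff_self subsetD)+
qed

text \<open>Records coboundaries rather than extensions: different extensions may share a
  coboundary, and uniqueness is claimed only for the latter.\<close>

definition extension_coboundaries ::
  "('v set \<Rightarrow> 'v list) \<Rightarrow> 'v set set \<Rightarrow> 'v set set \<Rightarrow> nat \<Rightarrow> 'v cochain \<Rightarrow> 'v cochain set" where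
  "extension_coboundaries ori L K k \<beta> =
     coboundary ori L k ` {\<beta>' \<in> cochains L k. restrict_cochain K k \<beta>' = \<beta>}"

lemma mem_rel_coh_class:
  "\<eta> \<in> rel_coh_class ori L K (k + 1) \<omega>
    \<longleftrightarrow> (\<exists>\<phi>\<in>rel_cochains L K k. \<eta> = (\<lambda>\<tau>. \<omega> \<tau> + coboundary ori L k \<phi> \<tau>))"
  by (auto simp: rel_coh_class_def rel_coboundaries_def)

lemma rel_coh_class_self: "\<omega> \<in> rel_coh_class ori L K (k + 1) \<omega>"
proof -
  have "(\<lambda>_. 0) \<in> rel_cochains L K k" by (simp add: rel_cochains_iff)
  moreover have "coboundary ori L k (\<lambda>_. 0) = (\<lambda>_. 0)"
    by (rule ext) (simp add: coboundary_def del: sum.atMost_Suc)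
  ultimately show ?thesis unfolding mem_rel_coh_class by (intro bexI[of _ "\<lambda>_. 0"]) auto
qed

lemma rel_coh_class_eqI:
  assumes "\<eta> \<in> rel_coh_class ori L K (k + 1) \<omega>"
  shows "rel_coh_class ori L K (k + 1) \<eta> = rel_coh_class ori L K (k + 1) \<omega>"
proof -
  obtain \<phi> where \<phi>: "\<phi> \<in> rel_cochains L K k" "\<eta> = (\<lambda>\<tau>. \<omega> \<tau> + coboundary ori L k \<phi> \<tau>)"
    using assms mem_rel_coh_class by blast
  show ?thesis
  proof (intro equalityI subsetI)
    fix \<zeta> assume "\<zeta> \<in> rel_coh_class ori L K (k + 1) \<eta>"
    then obtain \<psi> where \<psi>: "\<psi> \<in> rel_cochains L K k" "\<zeta> = (\<lambda>\<tau>. \<eta> \<tau> + coboundary ori L k \<psi> \<tau>)"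
      using mem_rel_coh_class by blast
    show "\<zeta> \<in> rel_coh_class ori L K (k + 1) \<omega>"
      unfolding mem_rel_coh_class
      by (rule bexI[of _ "\<lambda>\<sigma>. \<phi> \<sigma> + \<psi> \<sigma>"])
        (use \<phi> \<psi> in \<open>auto simp: coboundary_add rel_cochains_iff\<close>)
  next
    fix \<zeta> assume "\<zeta> \<in> rel_coh_class ori L K (k + 1) \<omega>"
    then obtain \<psi> where \<psi>: "\<psi> \<in> rel_cochains L K k" "\<zeta> = (\<lambda>\<tau>. \<omega> \<tau> + coboundary ori L k \<psi> \<tau>)"
      using mem_rel_coh_class by blast
    show "\<zeta> \<in> rel_coh_class ori L K (k + 1) \<eta>"
      unfolding mem_rel_coh_class
      by (rule bexI[of _ "\<lambda>\<sigma>. \<psi> \<sigma> - \<phi> \<sigma>"])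
        (use \<phi> \<psi> in \<open>auto simp: coboundary_diff rel_cochains_iff\<close>)
  qed
qed

text \<open>Linearity of the coboundary carries the translate of the relative cochains to a coset of
  their coboundaries. On the right, \<open>\<beta>\<close> is read as its extension by zero.\<close>

lemma extension_coboundaries_eq_class:
  assumes "subcomplex K L" "\<beta> \<in> cochains K k"
  shows "extension_coboundaries ori L K k \<beta>
    = rel_coh_class ori L K (k + 1) (coboundary ori L k \<beta>)"
proof (intro equalityI subsetI)
  fix \<eta> assume "\<eta> \<in> extension_coboundaries ori L K k \<beta>"
  then obtain \<beta>' where \<beta>': "\<eta> = coboundary ori L k \<beta>'" "(\<lambda>\<sigma>. \<beta>' \<sigma> - \<beta> \<sigma>) \<in> rel_cochains L K k"
    using extension_iff[OF assms] by (auto simp: extension_coboundaries_def)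
  then show "\<eta> \<in> rel_coh_class ori L K (k + 1) (coboundary ori L k \<beta>)"
    unfolding mem_rel_coh_class
    by (intro bexI[of _ "\<lambda>\<sigma>. \<beta>' \<sigma> - \<beta> \<sigma>"]) (auto simp: coboundary_diff)
next
  fix \<eta> assume "\<eta> \<in> rel_coh_class ori L K (k + 1) (coboundary ori L k \<beta>)"
  then obtain \<phi> where \<phi>: "\<phi> \<in> rel_cochains L K k"
    "\<eta> = (\<lambda>\<tau>. coboundary ori L k \<beta> \<tau> + coboundary ori L k \<phi> \<tau>)"
    using mem_rel_coh_class by blast
  then have "\<eta> = coboundary ori L k (\<lambda>\<sigma>. \<beta> \<sigma> + \<phi> \<sigma>)" by (simp add: coboundary_add)
  moreover have "(\<lambda>\<sigma>. \<beta> \<sigma> + \<phi> \<sigma>) \<in> cochains L k \<and> restrict_cochain K k (\<lambda>\<sigma>. \<beta> \<sigma> + \<phi> \<sigma>) = \<beta>"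
    using extension_iff[OF assms, of "\<lambda>\<sigma>. \<beta> \<sigma> + \<phi> \<sigma>"] \<phi>(1) by simp
  ultimately show "\<eta> \<in> extension_coboundaries ori L K k \<beta>"
    by (auto simp: extension_coboundaries_def)
qed

section \<open>Independence of the connecting homomorphism from choices\<close>

text \<open>A primitive on \<open>K\<close>, extended by zero to \<open>L\<close>, has a coboundary
  in \<open>L\<close> that is closed and restricts to \<open>\<gamma>\<close>. In degree 0 only the
  zero cochain has to be lifted.\<close>

lemma ex_coboundary_lift:
  assumes KL: "subcomplex K L" and ori: "orientation L ori" and \<gamma>: "\<gamma> \<in> coboundaries ori K k"
  shows "\<exists>\<gamma>'\<in>cochains L k. restrict_cochain K k \<gamma>' = \<gamma> \<and> coboundary ori L k \<gamma>' = (\<lambda>_. 0)"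
proof (cases k)
  case 0
  then have "\<gamma> = (\<lambda>_. 0)" using \<gamma> by (simp add: coboundaries_def)
  then show ?thesis
    by (intro bexI[of _ "\<lambda>_. 0"])
      (auto simp: restrict_cochain_def cochains_def coboundary_def fun_eq_iff)
next
  case (Suc j)
  then obtain \<phi> where \<phi>: "\<phi> \<in> cochains K j" "\<gamma> = coboundary ori K j \<phi>"
    using \<gamma> by (auto simp: coboundaries_def)
  have "restrict_cochain K j \<phi> = \<phi>"
    using \<phi>(1) by (auto simp: restrict_cochain_def cochains_def fun_eq_iff)
  then have "restrict_cochain K k (coboundary ori L j \<phi>) = \<gamma>"
    using restrict_coboundary[OF KL ori] \<phi>(2) Suc by simp
  moreover have "coboundary ori L k (coboundary ori L j \<phi>) = (\<lambda>_. 0)"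
    using coboundary_coboundary KL ori Suc by (auto simp: subcomplex_def)
  ultimately show ?thesis
    using coboundary_in_cochains[of ori L j \<phi>] Suc by auto
qed

text \<open>Evaluates the definite description. The extension by zero of \<open>\<beta>\<close>
  attains the value; any other representative differs by a coboundary, whose lift to a cocycle of
  \<open>L\<close> can be subtracted without changing the class.\<close>

lemma connecting_hom_coh_class:
  assumes KL: "subcomplex K L" and ori: "orientation L ori" and \<beta>: "\<beta> \<in> cochains K k"
  shows "connecting_hom ori L K k (coh_class ori K k \<beta>)
    = rel_coh_class ori L K (k + 1) (coboundary ori L k \<beta>)"
  unfolding connecting_hom_def
proof (rule the_equality)
  have "(\<lambda>_. 0) \<in> coboundaries ori K k"
  proof (cases k)
    case (Suc j)
    have "coboundary ori K j (\<lambda>_. 0) = (\<lambda>_. 0)"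
      by (rule ext) (simp add: coboundary_def del: sum.atMost_Suc)
    then show ?thesis using Suc by (force simp: coboundaries_def cochains_def)
  qed (simp add: coboundaries_def)
  then have "\<beta> \<in> coh_class ori K k \<beta>" by (force simp: coh_class_def)
  moreover have "\<beta> \<in> cochains L k \<and> restrict_cochain K k \<beta> = \<beta>"
    using extension_iff[OF KL \<beta>, of \<beta>] by (simp add: rel_cochains_iff)
  ultimately show "\<exists>\<beta>\<^sub>1\<in>coh_class ori K k \<beta>. \<exists>\<beta>'\<in>cochains L k. restrict_cochain K k \<beta>' = \<beta>\<^sub>1 \<and>
      rel_coh_class ori L K (k + 1) (coboundary ori L k \<beta>)
        = rel_coh_class ori L K (k + 1) (coboundary ori L k \<beta>')"
    by blast
next
  fix d
  assume "\<exists>\<beta>\<^sub>1\<in>coh_class ori K k \<beta>. \<exists>\<beta>'\<in>cochains L k. restrict_cochain K k \<beta>' = \<beta>\<^sub>1 \<and>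
      d = rel_coh_class ori L K (k + 1) (coboundary ori L k \<beta>')"
  then obtain \<gamma> \<beta>' where *: "\<gamma> \<in> coboundaries ori K k" "\<beta>' \<in> cochains L k"
    "restrict_cochain K k \<beta>' = (\<lambda>\<sigma>. \<beta> \<sigma> + \<gamma> \<sigma>)"
    "d = rel_coh_class ori L K (k + 1) (coboundary ori L k \<beta>')"
    by (auto simp: coh_class_def)
  obtain \<gamma>' where \<gamma>': "\<gamma>' \<in> cochains L k" "restrict_cochain K k \<gamma>' = \<gamma>"
    "coboundary ori L k \<gamma>' = (\<lambda>_. 0)"
    using ex_coboundary_lift[OF KL ori *(1)] by blast
  \<comment> \<open>An extension of \<open>\<beta>\<close> itself with the same coboundary as
    \<open>\<beta>'\<close>.\<close>
  let ?\<beta>'' = "\<lambda>\<sigma>. \<beta>' \<sigma> - \<gamma>' \<sigma>"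
  have "?\<beta>'' \<in> cochains L k"
    using * \<gamma>' by (simp add: cochains_def)
  moreover have "restrict_cochain K k ?\<beta>'' = \<beta>"
  proof
    fix \<sigma>
    have "restrict_cochain K k \<beta>' \<sigma> - restrict_cochain K k \<gamma>' \<sigma> = \<beta> \<sigma>"
      using *(3) \<gamma>'(2) by simp
    then show "restrict_cochain K k ?\<beta>'' \<sigma> = \<beta> \<sigma>"
      by (auto simp: restrict_cochain_def split: if_splits)
  qed
  moreover have "coboundary ori L k ?\<beta>'' = coboundary ori L k \<beta>'"
    using \<gamma>'(3) by (simp add: coboundary_diff)
  ultimately have "coboundary ori L k \<beta>' \<in> extension_coboundaries ori L K k \<beta>"
    by (auto simp: extension_coboundaries_def intro!: image_eqI[of _ _ ?\<beta>''])
  then show "d = rel_coh_class ori L K (k + 1) (coboundary ori L k \<beta>)"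
    using *(4) extension_coboundaries_eq_class[OF KL \<beta>] rel_coh_class_eqI by blast
qed

text \<open>A coset consists of the cochains whose class it is. Its members are relative cocycles:
  they restrict on \<open>K\<close> to the coboundary of the cocycle \<open>\<beta>\<close>, which
  is zero, and they are closed as coboundaries.\<close>

lemma extension_coboundaries_eq_rel_cocycles:
  assumes KL: "subcomplex K L" and ori: "orientation L ori" and \<beta>: "\<beta> \<in> cocycles ori K k"
  shows "extension_coboundaries ori L K k \<beta>
    = {\<eta> \<in> rel_cocycles ori L K (k + 1).
        rel_coh_class ori L K (k + 1) \<eta> = connecting_hom ori L K k (coh_class ori K k \<beta>)}"
proof -
  have \<beta>C: "\<beta> \<in> cochains K k" and \<beta>0: "coboundary ori K k \<beta> = (\<lambda>_. 0)"
    using \<beta> by (auto simp: cocycles_def)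
  have "\<eta> \<in> rel_cocycles ori L K (k + 1)" if \<eta>: "\<eta> \<in> extension_coboundaries ori L K k \<beta>" for \<eta>
  proof -
    obtain \<beta>' where \<beta>': "\<eta> = coboundary ori L k \<beta>'" "restrict_cochain K k \<beta>' = \<beta>"
      using \<eta> by (auto simp: extension_coboundaries_def)
    then have "restrict_cochain K (k + 1) \<eta> = (\<lambda>_. 0)"
      using restrict_coboundary[OF KL ori, of k \<beta>'] \<beta>0 by simp
    moreover have "coboundary ori L (k + 1) \<eta> = (\<lambda>_. 0)"
      using \<beta>' coboundary_coboundary KL ori by (auto simp: subcomplex_def)
    ultimately show ?thesis
      using coboundary_in_cochains[of ori L k \<beta>'] \<beta>'(1)
      by (simp add: rel_cocycles_def rel_cochains_def)
  qed
  then show ?thesis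
    using rel_coh_class_self rel_coh_class_eqI
    unfolding connecting_hom_coh_class[OF KL ori \<beta>C] extension_coboundaries_eq_class[OF KL \<beta>C]
    by blast
qed

section \<open>The least-norm element of the class\<close>

text \<open>The minimizer is the element orthogonal to all relative coboundaries. Strictness of the
  inequality yields existence and uniqueness together.\<close>

lemma ex_unique_least_norm:
  assumes KL: "subcomplex K L" and \<beta>: "\<beta> \<in> cochains K k"
  obtains \<omega> where "\<omega> \<in> extension_coboundaries ori L K k \<beta>"
    "\<And>\<eta>. \<eta> \<in> extension_coboundaries ori L K k \<beta> \<Longrightarrow> \<eta> \<noteq> \<omega>
      \<Longrightarrow> cochain_norm L (k + 1) \<omega> < cochain_norm L (k + 1) \<eta>"
proof -
  \<comment> \<open>The indicators of members of \<open>I\<close> form a basis of the relative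
    cochains; their coboundaries \<open>f\<close> span the relative coboundaries, possibly with
    dependencies.\<close>
  define I where "I = simplices L k - simplices K k"
  define S where "S = simplices L (k + 1)"
  define f where "f = (\<lambda>\<rho>. coboundary ori L k (indicator {\<rho>}))"
  have fin: "finite I" "finite S"
    using KL by (auto simp: I_def S_def simplices_def subcomplex_def abstract_complex_def)
  have \<phi>_sum: "coboundary ori L k \<phi> = (\<lambda>\<tau>. \<Sum>\<rho>\<in>I. \<phi> \<rho> * f \<rho> \<tau>)" if "\<phi> \<in> rel_cochains L K k" for \<phi>
  proof -
    have "\<phi> = (\<lambda>\<sigma>. \<Sum>\<rho>\<in>I. \<phi> \<rho> * indicator {\<rho>} \<sigma>)"
      using that fin by (intro cochain_eq_sum_indicators) (auto simp: rel_cochains_iff I_def)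
    then have "coboundary ori L k \<phi> = coboundary ori L k (\<lambda>\<sigma>. \<Sum>\<rho>\<in>I. \<phi> \<rho> * indicator {\<rho>} \<sigma>)"
      by (rule arg_cong)
    then show ?thesis by (simp add: coboundary_sum f_def)
  qed
  obtain c where c: "(\<Sum>s\<in>S. (coboundary ori L k \<beta> s + (\<Sum>\<rho>\<in>I. c \<rho> * f \<rho> s)) * f j s) = 0"
    if "j \<in> I" for j
    using ex_orthogonal_residual[OF fin] by blast
  \<comment> \<open>The coefficients are unconstrained outside \<open>I\<close>, so they are cut off
    there to give a relative cochain.\<close>
  define \<phi>\<^sub>0 where "\<phi>\<^sub>0 = (\<lambda>\<rho>. if \<rho> \<in> I then c \<rho> else 0)"
  have \<phi>\<^sub>0: "\<phi>\<^sub>0 \<in> rel_cochains L K k" by (simp add: \<phi>\<^sub>0_def rel_cochains_iff I_def)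
  define \<omega> where "\<omega> = (\<lambda>\<tau>. coboundary ori L k \<beta> \<tau> + coboundary ori L k \<phi>\<^sub>0 \<tau>)"
  have \<omega>_mem: "\<omega> \<in> rel_coh_class ori L K (k + 1) (coboundary ori L k \<beta>)"
    unfolding mem_rel_coh_class \<omega>_def using \<phi>\<^sub>0 by blast
  have "coboundary ori L k \<phi>\<^sub>0 = (\<lambda>\<tau>. \<Sum>\<rho>\<in>I. c \<rho> * f \<rho> \<tau>)"
    using \<phi>_sum[OF \<phi>\<^sub>0] by (simp add: \<phi>\<^sub>0_def)
  then have orth: "(\<Sum>s\<in>S. \<omega> s * f j s) = 0" if "j \<in> I" for j
    using c[OF that] by (simp add: \<omega>_def)
  have less: "cochain_norm L (k + 1) \<omega> < cochain_norm L (k + 1) \<eta>"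
    if \<eta>: "\<eta> \<in> rel_coh_class ori L K (k + 1) (coboundary ori L k \<beta>)" and ne: "\<eta> \<noteq> \<omega>" for \<eta>
  proof -
    \<comment> \<open>Recentring the coset at \<open>\<omega>\<close> writes \<open>\<eta>\<close>
      as \<open>\<omega>\<close> plus a relative coboundary, which is orthogonal to
      \<open>\<omega>\<close>.\<close>
    have "\<eta> \<in> rel_coh_class ori L K (k + 1) \<omega>"
      using \<eta> rel_coh_class_eqI[OF \<omega>_mem] by simp
    then obtain \<phi> where \<phi>: "\<phi> \<in> rel_cochains L K k" "\<eta> = (\<lambda>\<tau>. \<omega> \<tau> + coboundary ori L k \<phi> \<tau>)"
      using mem_rel_coh_class by blast
    let ?v = "coboundary ori L k \<phi>"
    have "(\<Sum>s\<in>S. \<omega> s * ?v s) = (\<Sum>s\<in>S. \<Sum>j\<in>I. \<phi> j * (\<omega> s * f j s))"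
      using \<phi>_sum[OF \<phi>(1)] by (simp add: sum_distrib_left mult.left_commute)
    also have "\<dots> = (\<Sum>j\<in>I. \<phi> j * (\<Sum>s\<in>S. \<omega> s * f j s))"
      by (subst sum.swap) (simp add: sum_distrib_left)
    also have "\<dots> = 0" using orth by simp
    finally have "(L2_set \<eta> S)\<^sup>2 = (L2_set \<omega> S)\<^sup>2 + (L2_set ?v S)\<^sup>2"
      using L2_set_add_orthogonal \<phi>(2) by metis
    \<comment> \<open>The norm sees only \<open>S\<close>, but a coboundary vanishes off
      \<open>S\<close> by definition, so norm zero would force
      \<open>\<eta> = \<omega>\<close>.\<close>
    moreover have "L2_set ?v S \<noteq> 0"
    proof
      assume "L2_set ?v S = 0"
      then have "?v s = 0" for s
        using fin(2) by (cases "s \<in> S") (auto simp: L2_set_eq_0_iff S_def coboundary_def)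
      then show False using ne \<phi>(2) by simp
    qed
    ultimately have "(L2_set \<omega> S)\<^sup>2 < (L2_set \<eta> S)\<^sup>2" by simp
    then show ?thesis
      using power2_less_imp_less by (fastforce simp: cochain_norm_def S_def)
  qed
  show thesis
    by (rule that[of \<omega>]) (use \<omega>_mem less extension_coboundaries_eq_class[OF KL \<beta>] in auto)
qed

text \<open>The objective depends on an extension only through its coboundary, so the minimization
  can be carried out over the image.\<close>

lemma death_cochain_iff:
  "death_cochain ori K L k \<beta> \<omega>
    \<longleftrightarrow> is_arg_min (cochain_norm L (k + 1)) (\<lambda>\<eta>. \<eta> \<in> extension_coboundaries ori L K k \<beta>) \<omega>"
  by (auto simp: death_cochain_def is_arg_min_def extension_coboundaries_def)

theorem proposition4p2:
  fixes K L :: "'v set set"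
    and ori :: "'v set \<Rightarrow> 'v list"
    and k :: nat
    and \<beta> :: "'v cochain"
  assumes "subcomplex K L"
    and "orientation L ori"
    and "\<beta> \<in> cocycles ori K k"
    and "dies ori K L k \<beta>"
  shows "(\<exists>!\<omega>. death_cochain ori K L k \<beta> \<omega>) \<and>
    (\<forall>\<omega>. death_cochain ori K L k \<beta> \<omega> \<longrightarrow>
       {\<eta>. is_arg_min (cochain_norm L (k + 1))
          (\<lambda>\<eta>. \<eta> \<in> rel_cocycles ori L K (k + 1) \<and>
             rel_coh_class ori L K (k + 1) \<eta> = connecting_hom ori L K k (coh_class ori K k \<beta>)) \<eta>}
       = {\<omega>})"
proof -
  have "\<beta> \<in> cochains K k" using assms(3) by (simp add: cocycles_def)
  then obtain \<omega>\<^sub>0 where \<omega>\<^sub>0: "\<omega>\<^sub>0 \<in> extension_coboundaries ori L K k \<beta>"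
    "\<And>\<eta>. \<eta> \<in> extension_coboundaries ori L K k \<beta> \<Longrightarrow> \<eta> \<noteq> \<omega>\<^sub>0
      \<Longrightarrow> cochain_norm L (k + 1) \<omega>\<^sub>0 < cochain_norm L (k + 1) \<eta>"
    using ex_unique_least_norm[OF assms(1)] by metis
  \<comment> \<open>A competitor other than \<open>\<omega>\<^sub>0\<close> is strictly beaten by
    \<open>\<omega>\<^sub>0\<close>, while nothing beats \<open>\<omega>\<^sub>0\<close>
    itself.\<close>
  then have arg_min: "is_arg_min (cochain_norm L (k + 1))
      (\<lambda>\<eta>. \<eta> \<in> extension_coboundaries ori L K k \<beta>) \<eta> \<longleftrightarrow> \<eta> = \<omega>\<^sub>0" for \<eta>
    unfolding is_arg_min_def by (metis less_asym)
  \<comment> \<open>With equal feasible sets, both problems have \<open>\<omega>\<^sub>0\<close> as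
    their only solution.\<close>
  have "(\<lambda>\<eta>. \<eta> \<in> rel_cocycles ori L K (k + 1) \<and>
        rel_coh_class ori L K (k + 1) \<eta> = connecting_hom ori L K k (coh_class ori K k \<beta>))
      = (\<lambda>\<eta>. \<eta> \<in> extension_coboundaries ori L K k \<beta>)"
    using extension_coboundaries_eq_rel_cocycles[OF assms(1-3)] by auto
  then show ?thesis
    by (simp only: death_cochain_iff arg_min) auto
qed

end
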